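(* Let $g:\{0,1\}^*\to\{0,1\}^*$ and $\ell:\{0,1\}^*\to\{0,1,2\}^*$ be the morphisms given by $g:0\mapsto 01,\ 1\mapsto 011$ and $\ell:0\mapsto 012,\ 1\mapsto 0022$, and let $v=(v_n)_{n\ge1}=\ell(g^{\infty}(0))$. Then the increasing sequences of integers defined by $v^{-1}(0)$, $v^{-1}(1)$, $v^{-1}(2)$ form a partition of the set of positive integers. Furthermore, with $\varphi=\frac{1+\sqrt5}{2}$: (1) $v^{-1}(0)=\{1,4,5,8,11,12,\ldots\}$ is equal to the sequence $(2\lfloor n\varphi\rfloor-n)_{n\ge1}$; (2) $v^{-1}(1)=\{2,9,20,27,\ldots\}$ is equal to the sequence $(4\lfloor n\varphi\rfloor+3n+2)_{n\ge0}$; (3) $v^{-1}(2)=\{3,6,7,10,13,14,\ldots\}$ is equal to the sequence $(2\lfloor n\varphi\rfloor-n+2)_{n\ge1}$.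
   Context: A morphism is a monoid homomorphism between free monoids, extended to infinite words letter by letter. $g^\infty(0)=\lim_{m\to\infty}g^m(0)$ is the infinite fixed point of $g$ starting with $0$. Infinite words are indexed from $1$, and $v^{-1}(i)=\{n\ge1: v_n=i\}$, identified with the increasing enumeration of its elements. *)

theory Defs
  imports
    Complex_Main
    "HOL-Library.Stream"
    "HOL-Library.Sublist"
    "HOL-Library.Infinite_Set"
    "HOL-Library.Disjoint_Sets"
begin

text \<open>
  The free monoid over an alphabet \<open>A\<close> is \<open>lists A\<close>; nothing is said about the values of a
  morphism on lists that are not words over \<open>A\<close>.
\<close>

definition word_morphism :: "'a set \<Rightarrow> 'b set \<Rightarrow> ('a list \<Rightarrow> 'b list) \<Rightarrow> bool" where
  "word_morphism A B h \<longleftrightarrow>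
     h ` lists A \<subseteq> lists B \<and> h [] = [] \<and>
     (\<forall>u\<in>lists A. \<forall>w\<in>lists A. h (u @ w) = h u @ h w)"

text \<open>
  The infinite concatenation \<open>h(s\<^sub>1) h(s\<^sub>2) h(s\<^sub>3) \<dots>\<close>. This is meaningful for morphisms that
  map no letter to the empty word, since \<^const>\<open>flat\<close> is underspecified on empty blocks.
\<close>

definition morphism_stream :: "('a list \<Rightarrow> 'b list) \<Rightarrow> 'a stream \<Rightarrow> 'b stream" where
  "morphism_stream h s = flat (smap (\<lambda>a. h [a]) s)"

definition words_converge_to :: "(nat \<Rightarrow> 'a list) \<Rightarrow> 'a stream \<Rightarrow> bool" where
  "words_converge_to u s \<longleftrightarrow> (\<forall>n. \<forall>\<^sub>F m in sequentially. prefix (stake n s) (u m))"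

definition word_lim :: "(nat \<Rightarrow> 'a list) \<Rightarrow> 'a stream" where
  "word_lim u = (THE s. words_converge_to u s)"

definition infinite_fixed_point :: "('a list \<Rightarrow> 'a list) \<Rightarrow> 'a \<Rightarrow> 'a stream" where
  "infinite_fixed_point h a = word_lim (\<lambda>m. (h ^^ m) [a])"

text \<open>
  Positions in infinite words start at 1, whereas \<^const>\<open>snth\<close> counts from 0.
\<close>

definition occurrences :: "'a stream \<Rightarrow> 'a \<Rightarrow> nat set" where
  "occurrences v a = {n. n \<ge> 1 \<and> v !! (n - 1) = a}"

definition golden_ratio :: real where
  "golden_ratio = (1 + sqrt 5) / 2"

end

theory Submission
  imports Defs
begin

text \<open>
  Let \<open>F k = \<lfloor>k \<phi>\<rfloor>\<close>. The fixed point of \<open>g\<close> is the Sturmian word with letters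
  \<open>s k = F (k + 1) - F k - 1\<close> (counting from \<open>k = 0\<close>), so its prefix of length \<open>k\<close> contains
  \<open>F k - k\<close> ones. Hence the block \<open>\<ell>(s k)\<close> is preceded in \<open>v\<close> by \<open>2 k + F k\<close> letters, \<open>F k\<close> of
  which are zeros, and the positions of the letters reduce to identities for \<open>F (F k + j)\<close>
  and \<open>F (k + F k + j)\<close> with small \<open>j\<close>. These follow from
  \<open>\<phi>\<^sup>2 = \<phi> + 1\<close> and the irrationality of \<open>\<phi>\<close>.
\<close>

section \<open>Streams and enumerations\<close>

lemma stake_inject: "s = t" if "\<And>n. stake n s = stake n t"
proof -
  have "s !! n = t !! n" for n
    using stake_nth[of n "Suc n" s] stake_nth[of n "Suc n" t] that[of "Suc n"] by simp
  then show ?thesis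
    by (metis ext stream_smap_nats)
qed

lemma words_converge_to_unique:
  assumes "words_converge_to u s" "words_converge_to u t"
  shows "s = t"
proof (rule stake_inject)
  fix n
  have "\<forall>\<^sub>F m in sequentially. prefix (stake n s) (u m) \<and> prefix (stake n t) (u m)"
    using assms by (auto simp: words_converge_to_def intro: eventually_conj)
  then obtain m where "prefix (stake n s) (u m)" "prefix (stake n t) (u m)"
    by (auto simp: eventually_sequentially)
  then show "stake n s = stake n t"
    by (metis append_eq_append_conv length_stake prefixE)
qed

lemma word_lim_eqI: "words_converge_to u s \<Longrightarrow> word_lim u = s"
  unfolding word_lim_def by (blast intro: the_equality words_converge_to_unique)

text \<open>The least value of an increasing \<open>f\<close> is \<open>f 0\<close>, and the least
  value above \<open>f n\<close> is \<open>f (Suc n)\<close>. Statements about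
  \<open>enumerate\<close> thus reduce to finding a range and checking monotonicity.\<close>

lemma enumerate_range_strict_mono:
  fixes f :: "nat \<Rightarrow> nat"
  assumes "strict_mono f"
  shows "enumerate (range f) n = f n"
proof -
  have inf: "infinite (range f)"
    using assms by (simp add: finite_image_iff strict_mono_imp_inj_on)
  show ?thesis
  proof (induction n)
    case 0
    show ?case
      unfolding enumerate_0
      by (rule Least_equality) (use assms in \<open>auto simp: strict_mono_less_eq\<close>)
  next
    case (Suc n)
    show ?case
      unfolding enumerate_Suc''[OF inf] Suc.IH
      by (rule Least_equality)
        (use assms in \<open>auto simp: strict_mono_less strict_mono_less_eq Suc_le_eq\<close>)
  qed
qed

text \<open>With \<open>f k\<close> the starting index of block \<open>k\<close>, this finds the
  block that contains index \<open>n\<close>. It serves for letters of \<open>v\<close>, for letters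
  of the fixed point and for the count of zeros.\<close>

lemma strict_mono_between:
  fixes f :: "nat \<Rightarrow> nat"
  assumes "strict_mono f" "f 0 = 0"
  obtains k where "f k \<le> n" "n < f (Suc k)"
proof -
  have "\<exists>k. f k \<le> n \<and> n < f (Suc k)"
  proof (induction n)
    case 0
    show ?case
      using assms by (metis le_refl lessI strict_mono_less)
  next
    case (Suc n)
    then obtain k where k: "f k \<le> n" "n < f (Suc k)"
      by blast
    have "f (Suc k) < f (Suc (Suc k))"
      using assms(1) by (simp add: strict_mono_less)
    moreover have "f k \<le> Suc n"
      using k(1) by simp
    moreover have "f (Suc k) = Suc n" if "\<not> Suc n < f (Suc k)"
      using k(2) that by simp
    ultimately show ?case
      by (metis order_refl)
  qed
  with that show ?thesis by blast
qed

section \<open>The Beatty sequence of the golden ratio\<close>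

lemma golden_ratio_square: "golden_ratio * golden_ratio = golden_ratio + 1"
  by (simp add: golden_ratio_def field_simps)

lemma golden_ratio_bounds: "1.618 < golden_ratio" "golden_ratio < 1.6181"
proof -
  have "2.236 < sqrt 5"
    by (rule real_less_rsqrt) (simp add: power2_eq_square)
  moreover have "sqrt 5 < 2.2362"
    by (rule real_less_lsqrt) (simp_all add: power2_eq_square)
  ultimately show "1.618 < golden_ratio" "golden_ratio < 1.6181"
    by (auto simp: golden_ratio_def)
qed

text \<open>Irrationality of \<phi> by descent: if a/b = \<phi> then also b/(a - b) = \<phi>, and b
  < a < 2b makes the new denominator a - b positive and smaller than b.\<close>

lemma no_golden_ratio_nat: "a * a = a * b + b * b \<Longrightarrow> b = 0" for a b :: nat
proof (induction b arbitrary: a rule: less_induct)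
  case (less b)
  show ?case
  proof (rule ccontr)
    assume "b \<noteq> 0"
    have "b < a"
    proof (rule ccontr)
      assume "\<not> b < a"
      then have "a * a \<le> a * b" by simp
      with less.prems \<open>b \<noteq> 0\<close> show False by simp
    qed
    have "a < 2 * b"
    proof (rule ccontr)
      assume "\<not> a < 2 * b"
      then have "a * (2 * b) \<le> a * a" by simp
      moreover have "b * b < a * b" using \<open>b < a\<close> \<open>b \<noteq> 0\<close> by simp
      ultimately show False using less.prems by simp
    qed
    obtain c where c: "a = b + c" using \<open>b < a\<close> less_imp_add_positive by blast
    have "b * b = b * c + c * c"
      using less.prems by (simp add: c algebra_simps)
    with less.IH[of c b] c \<open>a < 2 * b\<close> \<open>b < a\<close> show False by simp
  qed
qed

definition beatty :: "nat \<Rightarrow> nat" where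
  "beatty k = nat \<lfloor>real k * golden_ratio\<rfloor>"

lemma int_beatty: "int (beatty k) = \<lfloor>real k * golden_ratio\<rfloor>"
  using golden_ratio_bounds by (simp add: beatty_def)

lemma beatty_eqI:
  "real n \<le> real k * golden_ratio \<Longrightarrow> real k * golden_ratio < real n + 1 \<Longrightarrow> beatty k = n"
  unfolding beatty_def by linarith

lemma beatty_bounds:
  "real (beatty k) \<le> real k * golden_ratio" "real k * golden_ratio < real (beatty k) + 1"
  using int_beatty[of k] by linarith+

lemma beatty_0 [simp]: "beatty 0 = 0"
  by (simp add: beatty_def)

lemma beatty_1 [simp]: "beatty (Suc 0) = 1"
  using golden_ratio_bounds by (intro beatty_eqI) auto

lemma beatty_Suc_cases:
  obtains "beatty (Suc k) = beatty k + 1" | "beatty (Suc k) = beatty k + 2"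
proof -
  have "real (Suc k) * golden_ratio = real k * golden_ratio + golden_ratio"
    by (simp add: algebra_simps)
  with beatty_bounds[of k] beatty_bounds[of "Suc k"] golden_ratio_bounds
  have "real (beatty (Suc k)) < real (beatty k + 3)" "real (beatty k) < real (beatty (Suc k))"
    by simp_all
  then show thesis
    using that by force
qed

lemma strict_mono_beatty: "strict_mono beatty"
  unfolding strict_mono_Suc_iff
  by (metis beatty_Suc_cases less_add_same_cancel1 zero_less_numeral zero_less_one)

lemma le_beatty: "k \<le> beatty k"
  by (rule strict_mono_imp_increasing[OF strict_mono_beatty])

text \<open>
  With \<open>f\<close> the fractional part of \<open>k \<phi>\<close>, one has \<open>F k \<phi> = F k + k - (\<phi> - 1) f\<close>. Naming the
  product \<open>d = (\<phi> - 1) f\<close> keeps the floor estimates below linear.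
\<close>

lemma beatty_frac:
  obtains f d where
    "real k * golden_ratio = real (beatty k) + f"
    "real (beatty k) * golden_ratio = real (beatty k) + real k - d"
    "0 \<le> f" "f < 1" "0 \<le> d" "d < golden_ratio - 1" "0 \<le> f - d" "f - d < 2 - golden_ratio"
    "d = (golden_ratio - 1) * f"
proof
  define f where "f = real k * golden_ratio - real (beatty k)"
  have pos: "0 < golden_ratio - 1" "0 < 2 - golden_ratio"
    using golden_ratio_bounds by auto
  have f: "0 \<le> f" "f < 1"
    using beatty_bounds[of k] by (auto simp: f_def)
  have fd: "f - (golden_ratio - 1) * f = (2 - golden_ratio) * f"
    by (simp add: algebra_simps)
  show "real k * golden_ratio = real (beatty k) + f" "0 \<le> f" "f < 1"
    using f by (auto simp: f_def)
  have "golden_ratio * (real k * golden_ratio) = real k * (golden_ratio + 1)"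
    by (simp flip: golden_ratio_square)
  then show "real (beatty k) * golden_ratio = real (beatty k) + real k - (golden_ratio - 1) * f"
    by (simp add: f_def algebra_simps)
  show "0 \<le> (golden_ratio - 1) * f" "(golden_ratio - 1) * f < golden_ratio - 1"
    using pos f by auto
  show "0 \<le> f - (golden_ratio - 1) * f" "f - (golden_ratio - 1) * f < 2 - golden_ratio"
    unfolding fd using pos f by auto
qed simp

text \<open>Adding \<phi> to F k \<phi> = F k + k - d leaves the excess \<phi> - d over k + F k,
  which lies strictly between 1 and 2.\<close>

lemma beatty_beatty_1: "beatty (beatty k + 1) = k + beatty k + 1"
proof (rule beatty_frac[of k])
  fix f d :: real
  assume "real (beatty k) * golden_ratio = real (beatty k) + real k - d"
    "0 \<le> d" "d < golden_ratio - 1"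
  with golden_ratio_bounds show ?thesis
    by (intro beatty_eqI) (auto simp: algebra_simps)
qed

text \<open>The excess is now 2\<phi> - d, and it is below 3 only for d > 2\<phi> - 3 = (\<phi> -
  1)(2 - \<phi>), that is f > 2 - \<phi>. A jump of F by 2 at k gives this inequality.\<close>

lemma beatty_beatty_2:
  assumes "beatty (Suc k) = beatty k + 2"
  shows "beatty (beatty k + 2) = k + beatty k + 2"
proof (rule beatty_frac[of k])
  fix f d :: real
  assume *: "real k * golden_ratio = real (beatty k) + f"
    "real (beatty k) * golden_ratio = real (beatty k) + real k - d"
    "d = (golden_ratio - 1) * f" "d < golden_ratio - 1"
  have "real (beatty k + 2) \<le> real (Suc k) * golden_ratio"
    using assms beatty_bounds(1)[of "Suc k"] by simp
  \<comment> \<open>The jump alone gives only f \<ge> 2 - \<phi>. Equality would make the floor one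
    too large; it is excluded because \<phi> is irrational.\<close>
  moreover have "real (beatty k + 2) \<noteq> real (Suc k) * golden_ratio"
  proof
    define a b where "a = beatty k + 2" and "b = Suc k"
    assume "real (beatty k + 2) = real (Suc k) * golden_ratio"
    then have "real a = real b * golden_ratio" by (simp only: a_def b_def)
    then have "real a * real a = real b * real b * (golden_ratio * golden_ratio)"
      by simp
    also have "\<dots> = real a * real b + real b * real b"
      using \<open>real a = _\<close> by (simp add: golden_ratio_square algebra_simps)
    finally have "a * a = a * b + b * b"
      by (simp flip: of_nat_mult of_nat_add)
    then show False
      using no_golden_ratio_nat[of a b] by (simp add: b_def)
  qed
  ultimately have "2 - golden_ratio < f"
    using * by (simp add: algebra_simps)
  then have "(golden_ratio - 1) * (2 - golden_ratio) < d"
    using * golden_ratio_bounds by simp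
  then have "2 * golden_ratio - 3 < d"
    using golden_ratio_square by (simp add: algebra_simps)
  with * golden_ratio_bounds show ?thesis
    by (intro beatty_eqI) (auto simp: algebra_simps)
qed

text \<open>Adding the formulas for k \<phi> and F k \<phi> gives (k + F k) \<phi> = k + 2 F k + (f
  - d). Since 0 \<le> f - d < 2 - \<phi>, adding 0, \<phi> or 2\<phi> to f - d gives floors 0, 1 and
  3.\<close>

lemma beatty_add_beatty:
  "beatty (k + beatty k) = k + 2 * beatty k"
  "beatty (k + beatty k + 1) = k + 2 * beatty k + 1"
  "beatty (k + beatty k + 2) = k + 2 * beatty k + 3"
proof -
  obtain f d :: real where *: "real k * golden_ratio = real (beatty k) + f"
    "real (beatty k) * golden_ratio = real (beatty k) + real k - d"
    "0 \<le> f - d" "f - d < 2 - golden_ratio"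
    by (rule beatty_frac[of k])
  with golden_ratio_bounds show
    "beatty (k + beatty k) = k + 2 * beatty k"
    "beatty (k + beatty k + 1) = k + 2 * beatty k + 1"
    "beatty (k + beatty k + 2) = k + 2 * beatty k + 3"
    by (auto intro!: beatty_eqI simp: algebra_simps)
qed

lemma beatty_add_beatty_3:
  assumes "beatty (Suc k) = beatty k + 2"
  shows "beatty (k + beatty k + 3) = k + 2 * beatty k + 5"
proof -
  have "k + beatty k + 3 = Suc k + beatty (Suc k)" "k + 2 * beatty k + 5 = Suc k + 2 * beatty (Suc k)"
    using assms by auto
  then show ?thesis
    by (simp only: beatty_add_beatty)
qed

section \<open>The fixed point and its image\<close>

definition golden_word :: "nat stream" where
  "golden_word = smap (\<lambda>k. beatty (Suc k) - beatty k - 1) nats"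

lemma golden_word_cases:
  obtains (zero) "golden_word !! k = 0" "beatty (Suc k) = beatty k + 1"
    | (one) "golden_word !! k = 1" "beatty (Suc k) = beatty k + 2"
  by (rule beatty_Suc_cases[of k]) (auto simp: golden_word_def)

lemma golden_word_nth_in: "golden_word !! k \<in> {0, 1}"
  by (rule golden_word_cases[of k]) auto

lemma sset_golden_word: "sset golden_word \<subseteq> {0, 1}"
  unfolding sset_range image_subset_iff by (intro ballI golden_word_nth_in)

lemma stake_golden_word_in_lists: "stake k golden_word \<in> lists {0, 1}"
proof (induction k)
  case (Suc k)
  then show ?case
    unfolding stake_Suc using golden_word_nth_in[of k] by simp
qed simp

text \<open>The images of the first k letters under \<open>g\<close> have total length 2k + (F k -
  k) = k + F k, so these are the letters expected of the image of letter k. They are differences of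
  consecutive values of F.\<close>

lemma golden_word_at_block:
  "golden_word !! (k + beatty k) = 0"
  "golden_word !! (k + beatty k + 1) = 1"
  "beatty (Suc k) = beatty k + 2 \<Longrightarrow> golden_word !! (k + beatty k + 2) = 1"
proof -
  have *: "golden_word !! n = beatty (n + 1) - beatty n - 1" for n
    by (simp add: golden_word_def)
  have "k + beatty k + 1 + 1 = k + beatty k + 2" "k + beatty k + 2 + 1 = k + beatty k + 3"
    by simp_all
  with beatty_add_beatty[of k] beatty_add_beatty_3[of k] show
    "golden_word !! (k + beatty k) = 0"
    "golden_word !! (k + beatty k + 1) = 1"
    "beatty (Suc k) = beatty k + 2 \<Longrightarrow> golden_word !! (k + beatty k + 2) = 1"
    unfolding * by (simp_all only:)
qed

lemma golden_word_0 [simp]: "golden_word !! 0 = 0"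
  by (simp add: golden_word_def)

text \<open>Finite form of the fixed point property: one more letter on the left adds exactly the
  block read off at index k + F k on the right.\<close>

lemma morphism_stake_golden_word:
  assumes "word_morphism {0, 1} {0, 1} g" "g [0] = [0, 1]" "g [1] = [0, 1, 1]"
  shows "g (stake k golden_word) = stake (k + beatty k) golden_word"
proof (induction k)
  case 0
  show ?case using assms(1) by (simp add: word_morphism_def)
next
  case (Suc k)
  \<comment> \<open>\<open>word_morphism\<close> gives multiplicativity only for words over the
    alphabet.\<close>
  have "[golden_word !! k] \<in> lists {0, 1}"
    using golden_word_nth_in by simp
  then have "g (stake (Suc k) golden_word) = stake (k + beatty k) golden_word @ g [golden_word !! k]"
    using assms(1) stake_golden_word_in_lists[of k] Suc.IH
    by (simp add: word_morphism_def stake_Suc del: stake.simps(2))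
  also have "\<dots> = stake (Suc k + beatty (Suc k)) golden_word"
    using golden_word_at_block[of k] assms(2,3)
    by (cases k rule: golden_word_cases) (simp_all add: stake_Suc del: stake.simps(2))
  finally show ?case .
qed

lemma infinite_fixed_point_eq_golden_word:
  assumes "word_morphism {0, 1} {0, 1} g" "g [0] = [0, 1]" "g [1] = [0, 1, 1]"
  shows "infinite_fixed_point g 0 = golden_word"
  unfolding infinite_fixed_point_def
proof (rule word_lim_eqI)
  \<comment> \<open>Every iterate is a prefix of \<open>golden_word\<close>. The bound n > m makes
    the lengths unbounded, which yields convergence.\<close>
  have *: "\<exists>n>m. (g ^^ m) [0] = stake n golden_word" for m
  proof (induction m)
    case 0
    show ?case by (intro exI[of _ 1]) (use golden_word_0 in simp)
  next
    case (Suc m)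
    then obtain n where n: "n > m" "(g ^^ m) [0] = stake n golden_word"
      by blast
    then have "(g ^^ Suc m) [0] = stake (n + beatty n) golden_word"
      using morphism_stake_golden_word[OF assms] by simp
    moreover have "n + beatty n > Suc m"
      using n(1) le_beatty[of n] by linarith
    ultimately show ?case by blast
  qed
  show "words_converge_to (\<lambda>m. (g ^^ m) [0]) golden_word"
    unfolding words_converge_to_def eventually_sequentially
  proof (intro allI exI impI)
    fix n m :: nat
    assume "n \<le> m"
    moreover obtain k where "m < k" "(g ^^ m) [0] = stake k golden_word"
      using * by blast
    ultimately show "prefix (stake n golden_word) ((g ^^ m) [0])"
      using stake_add[of n golden_word "k - n"]
      by (metis le_add_diff_inverse less_imp_le order_trans prefixI)
  qed
qed

section \<open>The image word and its block boundaries\<close>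

definition golden_block :: "nat \<Rightarrow> nat list" where
  "golden_block a = (if a = 0 then [0, 1, 2] else [0, 0, 2, 2])"

definition coded_word :: "nat stream" where
  "coded_word = flat (smap golden_block golden_word)"

lemma morphism_stream_golden_word:
  assumes "l [0] = [0, 1, 2]" "l [1] = [0, 0, 2, 2]"
  shows "morphism_stream l golden_word = coded_word"
  unfolding morphism_stream_def coded_word_def
  by (rule arg_cong[of _ _ flat], rule stream.map_cong0)
    (use assms sset_golden_word in \<open>auto simp: golden_block_def\<close>)

lemma flat_golden_block:
  "flat (smap golden_block (sdrop k golden_word)) =
    golden_block (golden_word !! k) @- flat (smap golden_block (sdrop (Suc k) golden_word))"
proof -
  have "sdrop k golden_word = golden_word !! k ## sdrop (Suc k) golden_word"
    by (metis sdrop_simps stream.collapse)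
  \<comment> \<open>\<open>flat\<close> can be unfolded only over a nonempty first block.\<close>
  moreover have "golden_block (golden_word !! k) \<noteq> []"
    by (simp add: golden_block_def)
  ultimately show ?thesis
    by (metis flat_Stream stream.map_sel stream.collapse stream.sel)
qed

text \<open>Blocks have length 3 for the letter 0 and 4 for 1, so the first k blocks have total
  length 3k + (F k - k).\<close>

lemma sdrop_coded_word:
  "sdrop (2 * k + beatty k) coded_word = flat (smap golden_block (sdrop k golden_word))"
proof (induction k)
  case 0
  show ?case by (simp add: coded_word_def)
next
  case (Suc k)
  define b where "b = golden_block (golden_word !! k)"
  have "2 * Suc k + beatty (Suc k) = 2 * k + beatty k + length b"
    by (cases k rule: golden_word_cases) (auto simp: b_def golden_block_def)
  then have "sdrop (2 * Suc k + beatty (Suc k)) coded_word =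
      sdrop (length b) (sdrop (2 * k + beatty k) coded_word)"
    by (simp only: sdrop_add)
  also have "\<dots> = sdrop (length b) (b @- flat (smap golden_block (sdrop (Suc k) golden_word)))"
    unfolding Suc.IH flat_golden_block[of k] b_def ..
  finally show ?case
    by (simp add: sdrop_shift)
qed

section \<open>Positions of the letters 0, 1 and 2\<close>

lemma coded_word_nth:
  assumes "j < length (golden_block (golden_word !! k))"
  shows "coded_word !! (2 * k + beatty k + j) = golden_block (golden_word !! k) ! j"
proof -
  have "coded_word !! (2 * k + beatty k + j) = sdrop (2 * k + beatty k) coded_word !! j"
    by (simp only: sdrop_snth)
  with assms show ?thesis
    by (simp only: sdrop_coded_word flat_golden_block[of k] shift_snth_less)
qed

text \<open>A position is split into its block k and the offset j in that block; the final 1 passes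
  from indices counted from 0 to positions counted from 1.\<close>

lemma occurrences_coded_word_iff:
  "p \<in> occurrences coded_word a \<longleftrightarrow>
    (\<exists>k j. p = 2 * k + beatty k + j + 1 \<and> j < length (golden_block (golden_word !! k)) \<and>
      golden_block (golden_word !! k) ! j = a)" (is "_ \<longleftrightarrow> ?R")
proof
  assume p: "p \<in> occurrences coded_word a"
  define f where "f k = 2 * k + beatty k" for k
  have "strict_mono f" "f 0 = 0"
    using strict_mono_beatty by (auto simp: f_def strict_mono_def intro: add_less_mono)
  then obtain k where k: "f k \<le> p - 1" "p - 1 < f (Suc k)"
    by (rule strict_mono_between)
  define j where "j = p - 1 - f k"
  have "p = 2 * k + beatty k + j + 1"
    using k p by (auto simp: j_def f_def occurrences_def)
  moreover have "j < length (golden_block (golden_word !! k))"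
    using k by (cases k rule: golden_word_cases) (auto simp: f_def j_def golden_block_def)
  ultimately show ?R
    using p coded_word_nth[of j k] by (auto simp: occurrences_def)
qed (auto simp: occurrences_def coded_word_nth)

text \<open>Blocks before block k contain k + (F k - k) = F k zeros, and zeros lead each block. So
  the zero at offset j of block k has number F k + j + 1, and the formulas for F (F k + 1) and F (F
  k + 2) give its position.\<close>

lemma occurrences_coded_word_0:
  "occurrences coded_word 0 = range (\<lambda>n. 2 * beatty (Suc n) - Suc n)"
proof (intro set_eqI iffI)
  fix p
  assume "p \<in> occurrences coded_word 0"
  then obtain k j where kj: "p = 2 * k + beatty k + j + 1"
    "j < length (golden_block (golden_word !! k))" "golden_block (golden_word !! k) ! j = 0"
    unfolding occurrences_coded_word_iff by blast
  have "p = 2 * beatty (Suc (beatty k + j)) - Suc (beatty k + j)"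
  proof (cases k rule: golden_word_cases)
    case zero
    with kj have "j = 0"
      by (auto simp: golden_block_def less_Suc_eq numeral_3_eq_3)
    with kj beatty_beatty_1[of k] show ?thesis by simp
  next
    case one
    with kj have "j = 0 \<or> j = 1"
      by (auto simp: golden_block_def less_Suc_eq numeral_eq_Suc)
    with kj one beatty_beatty_1[of k] beatty_beatty_2[of k] show ?thesis by auto
  qed
  then show "p \<in> range (\<lambda>n. 2 * beatty (Suc n) - Suc n)"
    by blast
next
  fix p
  assume "p \<in> range (\<lambda>n. 2 * beatty (Suc n) - Suc n)"
  then obtain n where p: "p = 2 * beatty (Suc n) - Suc n"
    by blast
  \<comment> \<open>Since F k zeros precede block k, the zero with index n, counted from 0, lies in
    this block.\<close>
  obtain k where k: "beatty k \<le> n" "n < beatty (Suc k)"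
    using strict_mono_beatty beatty_0 by (rule strict_mono_between)
  define j where "j = n - beatty k"
  have n: "n = beatty k + j"
    using k by (simp add: j_def)
  have "p = 2 * k + beatty k + j + 1 \<and> j < length (golden_block (golden_word !! k)) \<and>
      golden_block (golden_word !! k) ! j = 0"
  proof (cases k rule: golden_word_cases)
    case zero
    with k n have "j = 0" by simp
    with p n zero beatty_beatty_1[of k] show ?thesis by (simp add: golden_block_def)
  next
    case one
    with k n have "j = 0 \<or> j = 1" by auto
    with p n one beatty_beatty_1[of k] beatty_beatty_2[of k] show ?thesis
      by (auto simp: golden_block_def)
  qed
  then show "p \<in> occurrences coded_word 0"
    unfolding occurrences_coded_word_iff by blast
qed

text \<open>In both 012 and 0022 the twos are the zeros moved two places to the right, so the
  positions of 2 follow from those of 0.\<close>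

lemma golden_block_2_iff_0:
  "(j < length (golden_block a) \<and> golden_block a ! j = 2) \<longleftrightarrow>
    (\<exists>i. j = i + 2 \<and> i < length (golden_block a) \<and> golden_block a ! i = 0)"
proof -
  have "(\<exists>i. j = i + 2 \<and> i < length (golden_block a) \<and> golden_block a ! i = 0) \<longleftrightarrow>
      2 \<le> j \<and> j - 2 < length (golden_block a) \<and> golden_block a ! (j - 2) = 0"
    by (auto simp: le_iff_add)
  then show ?thesis
    by (auto simp: golden_block_def numeral_eq_Suc less_Suc_eq nth_Cons split: nat.splits)
qed

lemma occurrences_coded_word_2:
  "occurrences coded_word 2 = range (\<lambda>n. 2 * beatty (Suc n) - Suc n + 2)"
proof -
  have shift: "(\<exists>j. p = c + j + 1 \<and> (\<exists>i. j = i + 2 \<and> Q i)) \<longleftrightarrow> (\<exists>i. p = c + i + 1 + 2 \<and> Q i)"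
    for p c :: nat and Q by auto
  have "p \<in> occurrences coded_word 2 \<longleftrightarrow> (\<exists>q \<in> occurrences coded_word 0. p = q + 2)" for p
  proof -
    have "p \<in> occurrences coded_word 2 \<longleftrightarrow>
        (\<exists>k i. p = 2 * k + beatty k + i + 1 + 2 \<and> i < length (golden_block (golden_word !! k)) \<and>
          golden_block (golden_word !! k) ! i = 0)"
      by (simp only: occurrences_coded_word_iff golden_block_2_iff_0 shift)
    also have "\<dots> \<longleftrightarrow> (\<exists>q \<in> occurrences coded_word 0. p = q + 2)"
      unfolding Bex_def occurrences_coded_word_iff by blast
    finally show ?thesis .
  qed
  then show ?thesis
    unfolding occurrences_coded_word_0 by auto
qed

text \<open>The fixed point is cut into blocks 01 and 011, each with its only zero in front; block n
  starts at index n + F n.\<close>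

lemma golden_word_0_iff: "golden_word !! k = 0 \<longleftrightarrow> (\<exists>n. k = n + beatty n)"
proof
  assume k: "golden_word !! k = 0"
  define f where "f n = n + beatty n" for n
  have "strict_mono f" "f 0 = 0"
    using strict_mono_beatty by (auto simp: f_def strict_mono_def intro: add_less_mono)
  then obtain n where n: "f n \<le> k" "k < f (Suc n)"
    by (rule strict_mono_between)
  have "k = f n"
    using n k golden_word_at_block[of n]
    by (cases n rule: golden_word_cases)
      (auto simp: f_def le_less less_Suc_eq numeral_eq_Suc dest!: less_imp_Suc_add)
  then show "\<exists>n. k = n + beatty n"
    by (auto simp: f_def)
qed (auto simp: golden_word_at_block)

text \<open>The letter 1 occurs only at offset 1 of a block 012, hence in block m = n + F n for some
  n. Its position 2m + F m + 2 simplifies by F m = n + 2 F n.\<close>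

lemma occurrences_coded_word_1:
  "occurrences coded_word 1 = range (\<lambda>n. 4 * beatty n + 3 * n + 2)"
proof -
  have "(j < length (golden_block a) \<and> golden_block a ! j = 1) \<longleftrightarrow> a = 0 \<and> j = 1" for j a
    by (auto simp: golden_block_def numeral_eq_Suc less_Suc_eq nth_Cons split: nat.splits)
  then have "p \<in> occurrences coded_word 1 \<longleftrightarrow>
      (\<exists>k. golden_word !! k = 0 \<and> p = 2 * k + beatty k + 1 + 1)" for p
    by (simp only: occurrences_coded_word_iff) blast
  then have "p \<in> occurrences coded_word 1 \<longleftrightarrow>
      (\<exists>n. p = 2 * (n + beatty n) + beatty (n + beatty n) + 1 + 1)" for p
    unfolding golden_word_0_iff by blast
  moreover have "2 * (n + beatty n) + beatty (n + beatty n) + 1 + 1 = 4 * beatty n + 3 * n + 2" for n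
    by (simp add: beatty_add_beatty)
  ultimately show ?thesis
    by auto
qed

section \<open>Increasing enumerations, infinitude and partition\<close>

lemma enumerate_coded_word_0:
  "enumerate (occurrences coded_word 0) n = 2 * beatty (Suc n) - Suc n"
  unfolding occurrences_coded_word_0
proof (rule enumerate_range_strict_mono, rule strict_mono_Suc_iff[THEN iffD2], rule allI)
  fix n
  show "2 * beatty (Suc n) - Suc n < 2 * beatty (Suc (Suc n)) - Suc (Suc n)"
    \<comment> \<open>F n \<ge> n keeps natural subtraction from truncating, and a step of F by 1 or
      2 raises the value by 1 or 3.\<close>
    using le_beatty[of "Suc n"] by (cases "Suc n" rule: beatty_Suc_cases) auto
qed

lemma enumerate_coded_word_1:
  "enumerate (occurrences coded_word 1) n = 4 * beatty n + 3 * n + 2"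
  unfolding occurrences_coded_word_1
proof (rule enumerate_range_strict_mono, rule strict_mono_Suc_iff[THEN iffD2], rule allI)
  fix n
  show "4 * beatty n + 3 * n + 2 < 4 * beatty (Suc n) + 3 * Suc n + 2"
    by (rule beatty_Suc_cases[of n]) auto
qed

lemma enumerate_coded_word_2:
  "enumerate (occurrences coded_word 2) n = 2 * beatty (Suc n) - Suc n + 2"
  unfolding occurrences_coded_word_2
proof (rule enumerate_range_strict_mono, rule strict_mono_Suc_iff[THEN iffD2], rule allI)
  fix n
  show "2 * beatty (Suc n) - Suc n + 2 < 2 * beatty (Suc (Suc n)) - Suc (Suc n) + 2"
    using le_beatty[of "Suc n"] by (cases "Suc n" rule: beatty_Suc_cases) auto
qed

lemma infinite_occurrences_coded_word:
  assumes "a \<in> {0, 1, 2}"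
  shows "infinite (occurrences coded_word a)"
proof -
  have "\<exists>p>k. p \<in> occurrences coded_word a" for k
  proof -
    \<comment> \<open>Block m is 012 and so contains the letter \<open>a\<close> at offset
      \<open>a\<close>; m \<ge> k puts it beyond position k.\<close>
    define m where "m = k + beatty k"
    have "golden_word !! m = 0"
      by (simp add: m_def golden_word_at_block)
    then have "2 * m + beatty m + a + 1 \<in> occurrences coded_word a"
      using assms unfolding occurrences_coded_word_iff
      by (intro exI[of _ m] exI[of _ a]) (auto simp: golden_block_def)
    moreover have "2 * m + beatty m + a + 1 > k"
      by (simp add: m_def)
    ultimately show ?thesis by blast
  qed
  then show ?thesis
    by (auto simp: infinite_nat_iff_unbounded)
qed

lemma coded_word_nth_in: "coded_word !! n \<in> {0, 1, 2}"
proof -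
  have "Suc n \<in> occurrences coded_word (coded_word !! n)"
    by (simp add: occurrences_def)
  then obtain k where "coded_word !! n \<in> set (golden_block (golden_word !! k))"
    unfolding occurrences_coded_word_iff by (metis nth_mem)
  then show ?thesis
    by (auto simp: golden_block_def split: if_splits)
qed

text \<open>A partition given as an image set cannot tell whether two letters share a class;
  disjointness indexed by letters rules this out.\<close>

lemma disjoint_family_occurrences: "disjoint_family_on (occurrences v) A"
  by (auto simp: disjoint_family_on_def occurrences_def)

lemma partition_occurrences_coded_word:
  "partition_on {1..} (occurrences coded_word ` {0, 1, 2})"
proof (rule partition_onI)
  show "\<Union> (occurrences coded_word ` {0, 1, 2}) = {1..}"
  proof (intro set_eqI iffI)
    fix p :: nat
    assume "p \<in> {1..}"
    then show "p \<in> \<Union> (occurrences coded_word ` {0, 1, 2})"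
      using coded_word_nth_in[of "p - 1"] by (auto simp: occurrences_def)
  qed (auto simp: occurrences_def)
  show "{} \<notin> occurrences coded_word ` {0, 1, 2}"
    using infinite_occurrences_coded_word by (metis finite.emptyI imageE)
qed (auto simp: disjnt_def occurrences_def)

lemma beatty_numerals:
  "beatty 2 = 3" "beatty 3 = 4" "beatty 4 = 6" "beatty 5 = 8" "beatty 6 = 9"
  using golden_ratio_bounds by (auto intro!: beatty_eqI)

theorem theorem25:
  fixes g l :: "nat list \<Rightarrow> nat list" and v :: "nat stream"
  assumes "word_morphism {0, 1} {0, 1} g"
    and "g [0] = [0, 1]" and "g [1] = [0, 1, 1]"
    and "word_morphism {0, 1} {0, 1, 2} l"
    and "l [0] = [0, 1, 2]" and "l [1] = [0, 0, 2, 2]"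
    and "v = morphism_stream l (infinite_fixed_point g 0)"
  shows "partition_on {1..} (occurrences v ` {0, 1, 2}) \<and>
         disjoint_family_on (occurrences v) {0, 1, 2} \<and>
         (\<forall>i\<in>{0, 1, 2}. infinite (occurrences v i)) \<and>
         map (enumerate (occurrences v 0)) [0..<6] = [1, 4, 5, 8, 11, 12] \<and>
         (\<forall>n\<ge>1. int (enumerate (occurrences v 0) (n - 1)) =
                  2 * \<lfloor>real n * golden_ratio\<rfloor> - int n) \<and>
         map (enumerate (occurrences v 1)) [0..<4] = [2, 9, 20, 27] \<and>
         (\<forall>n\<ge>0. int (enumerate (occurrences v 1) n) =
                  4 * \<lfloor>real n * golden_ratio\<rfloor> + 3 * int n + 2) \<and>
         map (enumerate (occurrences v 2)) [0..<6] = [3, 6, 7, 10, 13, 14] \<and>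
         (\<forall>n\<ge>1. int (enumerate (occurrences v 2) (n - 1)) =
                  2 * \<lfloor>real n * golden_ratio\<rfloor> - int n + 2)"
proof -
  have v: "v = coded_word"
    using assms infinite_fixed_point_eq_golden_word morphism_stream_golden_word by simp
  have upt: "[0..<4] = [0, 1, 2, 3]" "[0..<6] = [0, 1, 2, 3, 4, 5::nat]"
    by (simp_all add: upt_rec)
  have lists: "map (enumerate (occurrences v 0)) [0..<6] = [1, 4, 5, 8, 11, 12]"
    "map (enumerate (occurrences v 1)) [0..<4] = [2, 9, 20, 27]"
    "map (enumerate (occurrences v 2)) [0..<6] = [3, 6, 7, 10, 13, 14]"
    unfolding v upt
    by (simp_all add: enumerate_coded_word_0 enumerate_coded_word_1[simplified]
        enumerate_coded_word_2 beatty_numerals numeral_2_eq_2[symmetric])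
  \<comment> \<open>F n \<ge> n makes the natural difference agree with the integer one.\<close>
  have int_diff: "int (2 * beatty n - n) = 2 * \<lfloor>real n * golden_ratio\<rfloor> - int n" for n
    using le_beatty[of n] int_beatty[of n] by linarith
  have "\<forall>n\<ge>1. int (enumerate (occurrences v 0) (n - 1)) = 2 * \<lfloor>real n * golden_ratio\<rfloor> - int n"
    "\<forall>n\<ge>1. int (enumerate (occurrences v 2) (n - 1)) = 2 * \<lfloor>real n * golden_ratio\<rfloor> - int n + 2"
    unfolding v by (auto simp: enumerate_coded_word_0 enumerate_coded_word_2 int_diff)
  moreover have "\<forall>n\<ge>0. int (enumerate (occurrences v 1) n) =
      4 * \<lfloor>real n * golden_ratio\<rfloor> + 3 * int n + 2"
    unfolding v enumerate_coded_word_1 by (simp add: int_beatty)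
  moreover have "\<forall>i\<in>{0, 1, 2}. infinite (occurrences v i)"
    unfolding v using infinite_occurrences_coded_word by (rule ballI)
  moreover note lists partition_occurrences_coded_word[folded v]
    disjoint_family_occurrences[of v "{0, 1, 2}"]
  ultimately show ?thesis
    by (intro conjI)
qed

end
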